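(* For each pair of nonnegative integers $a,b$, let $$G_{a,b}(x)=\frac{1}{x^{2^a}}\sum_{n=0}^\infty \frac{x^{2^{n+a}}}{1-x^{2^{n+b}}}\in\mathbb{F}_2[[x]].$$ Then the Hankel determinant sequence $H(G_{a,b})$ (computed over $\mathbb{F}_2$) is ultimately periodic.
   Context: For a power series $f=\sum_{i\ge0}a_ix^i$ over a field and $n\ge1$, $H_n(f)=\det(a_{i+j})_{0\le i,j\le n-1}$, $H_0(f)=1$, and $H(f)=(H_0(f),H_1(f),\dots)$. A sequence is ultimately periodic if it is periodic from some index on. *)

theory Defs
  imports
    "HOL-Library.Z2"
    "HOL-Computational_Algebra.Formal_Power_Series"
    "Jordan_Normal_Form.Determinant"
begin

definition hankel_det :: "'a::field fps \<Rightarrow> nat \<Rightarrow> 'a" where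
  "hankel_det f n = det (mat n n (\<lambda>(i, j). fps_nth f (i + j)))"

lemma hankel_det_0: "hankel_det f 0 = 1"
  by (simp add: hankel_det_def)

definition ultimately_periodic :: "(nat \<Rightarrow> 'a) \<Rightarrow> bool" where
  "ultimately_periodic s \<longleftrightarrow> (\<exists>N p. p > 0 \<and> (\<forall>n\<ge>N. s (n + p) = s n))"

text \<open>The type \<open>bit\<close> is the field with two elements. The infinite sum is taken in the
  \<open>X\<close>-adic topology on formal power series.\<close>

definition G :: "nat \<Rightarrow> nat \<Rightarrow> bit fps" where
  "G a b = (\<Sum>n. fps_X ^ (2 ^ (n + a)) / (1 - fps_X ^ (2 ^ (n + b)))) / fps_X ^ (2 ^ a)"

text \<open>The two uses of totalised operators in the definition of \<open>G\<close> are proper: the sum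
  converges, and the division by \<open>X ^ (2 ^ a)\<close> is exact.\<close>

lemma G_term_eq:
  "fps_X ^ (2 ^ (n + a)) / (1 - fps_X ^ (2 ^ (n + b)) :: bit fps)
    = fps_X ^ (2 ^ (n + a)) * inverse (1 - fps_X ^ (2 ^ (n + b)))"
  by (rule fps_divide_unit) simp

lemma G_term_nth_eq_0:
  assumes "k < 2 ^ (n + a)"
  shows "fps_nth (fps_X ^ (2 ^ (n + a)) / (1 - fps_X ^ (2 ^ (n + b)) :: bit fps)) k = 0"
  using assms unfolding G_term_eq by (simp add: fps_X_power_mult_nth)

lemma G_sums:
  "(\<lambda>n. fps_X ^ (2 ^ (n + a)) / (1 - fps_X ^ (2 ^ (n + b)) :: bit fps)) sums
    Abs_fps (\<lambda>k. \<Sum>n\<le>k. fps_nth (fps_X ^ (2 ^ (n + a)) / (1 - fps_X ^ (2 ^ (n + b)))) k)"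
  (is "?t sums ?L")
  unfolding sums_def
proof (rule tendsto_fpsI)
  fix k
  have "fps_nth (\<Sum>n<N. ?t n) k = fps_nth ?L k" if "N > k" for N
  proof -
    have "(\<Sum>n<N. fps_nth (?t n) k) = (\<Sum>n\<le>k. fps_nth (?t n) k)"
    proof (rule sum.mono_neutral_right)
      show "\<forall>n\<in>{..<N} - {..k}. fps_nth (?t n) k = 0"
      proof
        fix n assume "n \<in> {..<N} - {..k}"
        then have "k < n + a" by simp
        also have "n + a < 2 ^ (n + a)" by (rule less_exp)
        finally show "fps_nth (?t n) k = 0" by (rule G_term_nth_eq_0)
      qed
    qed (use that in auto)
    then show ?thesis by (simp add: fps_sum_nth)
  qed
  then show "eventually (\<lambda>N. fps_nth (\<Sum>n<N. ?t n) k = fps_nth ?L k) sequentially"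
    unfolding eventually_sequentially by (intro exI[of _ "Suc k"]) auto
qed

lemma G_summable:
  "summable (\<lambda>n. fps_X ^ (2 ^ (n + a)) / (1 - fps_X ^ (2 ^ (n + b)) :: bit fps))"
  using G_sums by (rule sums_summable)

lemma G_mult_X_power:
  "G a b * fps_X ^ (2 ^ a) = (\<Sum>n. fps_X ^ (2 ^ (n + a)) / (1 - fps_X ^ (2 ^ (n + b))))"
    (is "_ = ?S")
proof -
  have S: "?S = Abs_fps (\<lambda>k. \<Sum>n\<le>k. fps_nth (fps_X ^ (2 ^ (n + a)) / (1 - fps_X ^ (2 ^ (n + b)))) k)"
    using G_sums by (rule sums_unique[symmetric])
  have "fps_nth ?S k = 0" if "k < 2 ^ a" for k
  proof -
    have "k < 2 ^ (n + a)" for n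
      using that by (rule order_less_le_trans) (simp add: power_increasing)
    then show ?thesis
      unfolding S by (simp add: G_term_nth_eq_0)
  qed
  then have "?S = fps_X ^ (2 ^ a) * fps_shift (2 ^ a) ?S"
    by (intro fps_ext) (simp add: fps_X_power_mult_nth)
  then have "(fps_X ^ (2 ^ a) :: bit fps) dvd ?S"
    by (rule dvdI)
  then show ?thesis
    unfolding G_def by (rule dvd_div_mult_self)
qed

end

theory Submission
  imports Defs
begin

text \<open>
  Write a nonzero power series as \<open>f = X ^ k / (D + X ^ (k + 2) * g)\<close> with a polynomial \<open>D\<close> of
  degree at most \<open>k + 1\<close> and \<open>D(0) \<noteq> 0\<close>. Translating kernel vectors of Hankel matrices into
  Pade approximants shows that the \<open>(n + k + 1)\<close>-st Hankel determinant of \<open>f\<close> vanishes iff the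
  \<open>n\<close>-th one of \<open>g\<close> does; over \<open>F\<^sub>2\<close> the two are then equal.

  In characteristic 2, if \<open>U + V f + W f\<^sup>2 = 0\<close> then
  \<open>U' + V g + X\<^sup>2 U g\<^sup>2 = 0\<close> for a polynomial \<open>U'\<close>: the middle coefficient does not change,
  and the bounds \<open>deg U < d\<close>, \<open>deg V < d + 1\<close>, \<open>deg W < d + 2\<close> are preserved. So the series reached
  from \<open>f\<close> are roots of finitely many quadratics, one of them recurs (or \<open>0\<close> is reached), and the
  Hankel determinants are ultimately periodic. The Frobenius map shifts the defining sum of
  \<open>X ^ 2 ^ a * G a b\<close> by one term, which gives a quadratic equation for \<open>G a b\<close>.
\<close>

section \<open>Polynomials as power series of bounded degree\<close>

text \<open>Polynomials stay inside the type of power series, so products with series need no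
  coercion. The bound is strict so that bound \<open>0\<close> singles out the zero
  polynomial.\<close>

definition fps_degree_less :: "'a::zero fps \<Rightarrow> nat \<Rightarrow> bool" where
  "fps_degree_less p n \<longleftrightarrow> (\<forall>i\<ge>n. fps_nth p i = 0)"

lemma fps_degree_less_0 [simp]: "fps_degree_less p 0 \<longleftrightarrow> p = 0"
  by (auto simp: fps_degree_less_def fps_eq_iff)

lemma fps_degree_less_mono: "fps_degree_less p m \<Longrightarrow> m \<le> n \<Longrightarrow> fps_degree_less p n"
  by (auto simp: fps_degree_less_def)

lemma fps_degree_less_add:
  fixes p q :: "'a::monoid_add fps"
  shows "fps_degree_less p n \<Longrightarrow> fps_degree_less q n \<Longrightarrow> fps_degree_less (p + q) n"
  by (auto simp: fps_degree_less_def)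

lemma fps_degree_less_diff:
  fixes p q :: "'a::group_add fps"
  shows "fps_degree_less p n \<Longrightarrow> fps_degree_less q n \<Longrightarrow> fps_degree_less (p - q) n"
  by (auto simp: fps_degree_less_def)

text \<open>For nonzero factors the degrees add up to at most \<open>m + n - 2\<close>, which is
  below \<open>l\<close>. Stating the bound with \<open>Suc l\<close> avoids truncated
  subtraction.\<close>

lemma fps_degree_less_mult:
  fixes p q :: "'a::semiring_0 fps"
  assumes "fps_degree_less p m" "fps_degree_less q n" "m + n \<le> Suc l"
  shows "fps_degree_less (p * q) l"
  unfolding fps_degree_less_def fps_mult_nth
proof (intro allI impI sum.neutral ballI)
  fix i j assume "l \<le> i" "j \<in> {0..i}"
  then have "m \<le> j \<or> n \<le> i - j" using assms(3) by auto
  then show "fps_nth p j * fps_nth q (i - j) = 0"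
    using assms(1,2) by (auto simp: fps_degree_less_def)
qed

lemma fps_degree_less_cutoff [simp]: "fps_degree_less (fps_cutoff n p) n"
  by (simp add: fps_degree_less_def)

lemma fps_degree_less_shift: "fps_degree_less p (n + k) \<Longrightarrow> fps_degree_less (fps_shift k p) n"
  by (simp add: fps_degree_less_def)

lemma fps_degree_less_X_power: "k < n \<Longrightarrow> fps_degree_less (fps_X ^ k :: 'a::comm_semiring_1 fps) n"
  by (simp add: fps_degree_less_def)

lemma fps_degree_less_eq_0_if_X_power_dvd:
  fixes p :: "'a::comm_semiring_1 fps"
  assumes "fps_degree_less p n" "fps_X ^ m dvd p" "n \<le> m"
  shows "p = 0"
proof (rule fps_ext)
  fix i
  from assms(2) obtain r where "p = fps_X ^ m * r" by (elim dvdE)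
  then show "fps_nth p i = fps_nth 0 i"
    using assms(1,3) by (cases "i < n") (simp_all add: fps_degree_less_def fps_X_power_mult_nth)
qed

lemma fps_X_power_times_shift_if_dvd:
  fixes p :: "'a::comm_semiring_1 fps"
  shows "fps_X ^ m dvd p \<Longrightarrow> fps_X ^ m * fps_shift m p = p"
  by (elim dvdE) (auto simp: fps_eq_iff fps_X_power_mult_nth)

lemma fps_cutoff_plus_shift:
  fixes f :: "'a::comm_semiring_1 fps"
  shows "fps_cutoff n f + fps_X ^ n * fps_shift n f = f"
  by (simp add: fps_eq_iff fps_X_power_mult_nth)

lemma finite_fps_degree_less: "finite {p :: 'a::{finite,zero} fps. fps_degree_less p n}"
proof (rule finite_subset)
  let ?F = "{g. \<forall>i. (i \<in> {..<n} \<longrightarrow> g i \<in> (UNIV :: 'a set)) \<and> (i \<notin> {..<n} \<longrightarrow> g i = 0)}"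
  show "finite (Abs_fps ` ?F)"
    by (intro finite_imageI finite_set_of_finite_funs) auto
  show "{p :: 'a fps. fps_degree_less p n} \<subseteq> Abs_fps ` ?F"
  proof
    fix p :: "'a fps" assume "p \<in> {p. fps_degree_less p n}"
    then have "fps_nth p \<in> ?F" by (auto simp: fps_degree_less_def)
    then show "p \<in> Abs_fps ` ?F" by (rule image_eqI[rotated]) (simp add: fps_nth_inverse)
  qed
qed

section \<open>Singular Hankel matrices and Pade approximants\<close>

text \<open>Listing the coefficients of \<open>q\<close> in reverse turns the Hankel product into a
  convolution: the indices \<open>i + j\<close> and \<open>n - 1 - j\<close> add up to
  \<open>n - 1 + i\<close>.\<close>

lemma hankel_mult_vec_nth:
  fixes f q :: "'a::field fps"
  assumes "fps_degree_less q n" "i < n"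
  shows "(mat n n (\<lambda>(i, j). fps_nth f (i + j)) *\<^sub>v vec n (\<lambda>j. fps_nth q (n - Suc j))) $ i
    = fps_nth (q * f) (n - 1 + i)"
proof -
  have "fps_nth (q * f) (n - 1 + i) = (\<Sum>l=0..n - 1 + i. fps_nth q l * fps_nth f (n - 1 + i - l))"
    by (rule fps_mult_nth)
  also have "\<dots> = (\<Sum>l<n. fps_nth q l * fps_nth f (n - 1 + i - l))"
    using assms by (intro sum.mono_neutral_right) (auto simp: fps_degree_less_def)
  also have "\<dots> = (\<Sum>j<n. fps_nth q (n - Suc j) * fps_nth f (n - 1 + i - (n - Suc j)))"
    by (rule sum.nat_diff_reindex[symmetric])
  also have "\<dots> = (\<Sum>j<n. fps_nth f (i + j) * fps_nth q (n - Suc j))"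
    by (intro sum.cong refl) (auto simp: mult.commute add.commute)
  finally show ?thesis
    using assms(2) by (simp add: scalar_prod_def atLeast0LessThan)
qed

text \<open>A kernel vector is a denominator \<open>q\<close> for which the coefficients
  \<open>n - 1\<close> to \<open>2 * n - 2\<close> of \<open>q * f\<close> vanish; the numerator
  \<open>p\<close> is the part of \<open>q * f\<close> below this gap. For \<open>n = 0\<close> both
  sides are false, since then \<open>q\<close> would be zero.\<close>

lemma hankel_det_eq_0_iff:
  fixes f :: "'a::field fps"
  shows "hankel_det f n = 0 \<longleftrightarrow>
    (\<exists>q p. q \<noteq> 0 \<and> fps_degree_less q n \<and> fps_degree_less p (n - 1) \<and>
      fps_X ^ (2 * n - 1) dvd q * f - p)" (is "_ \<longleftrightarrow> ?R")
proof -
  let ?A = "mat n n (\<lambda>(i, j). fps_nth f (i + j))"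
  let ?v = "\<lambda>q. vec n (\<lambda>j. fps_nth q (n - Suc j))"
  have "hankel_det f n = 0 \<longleftrightarrow> (\<exists>v. v \<in> carrier_vec n \<and> v \<noteq> 0\<^sub>v n \<and> ?A *\<^sub>v v = 0\<^sub>v n)"
    unfolding hankel_det_def by (rule det_0_iff_vec_prod_zero_field) simp
  also have "\<dots> \<longleftrightarrow> (\<exists>q. q \<noteq> 0 \<and> fps_degree_less q n \<and> ?A *\<^sub>v ?v q = 0\<^sub>v n)"
  proof safe
    fix v :: "'a vec" assume v: "v \<in> carrier_vec n" "v \<noteq> 0\<^sub>v n" "?A *\<^sub>v v = 0\<^sub>v n"
    define q where "q = Abs_fps (\<lambda>l. if l < n then v $ (n - Suc l) else 0)"
    have vq: "?v q = v" using v(1) by (intro eq_vecI) (auto simp: q_def)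
    moreover have "q \<noteq> 0" using v(2) vq by (auto simp: zero_vec_def)
    moreover have "fps_degree_less q n" by (simp add: q_def fps_degree_less_def)
    ultimately show "\<exists>q. q \<noteq> 0 \<and> fps_degree_less q n \<and> ?A *\<^sub>v ?v q = 0\<^sub>v n"
      using v(3) by auto
  next
    fix q :: "'a fps" assume q: "q \<noteq> 0" "fps_degree_less q n" "?A *\<^sub>v ?v q = 0\<^sub>v n"
    have "?v q \<noteq> 0\<^sub>v n"
    proof
      assume v0: "?v q = 0\<^sub>v n"
      have "fps_nth q l = 0" for l
      proof (cases "l < n")
        case True
        then have "fps_nth q l = ?v q $ (n - Suc l)" by simp
        with v0 True show ?thesis by simp
      qed (use q(2) in \<open>simp add: fps_degree_less_def\<close>)
      with q(1) show False by (simp add: fps_eq_iff)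
    qed
    with q(3) show "\<exists>v. v \<in> carrier_vec n \<and> v \<noteq> 0\<^sub>v n \<and> ?A *\<^sub>v v = 0\<^sub>v n"
      by (intro exI[of _ "?v q"]) auto
  qed
  also have "\<dots> \<longleftrightarrow> (\<exists>q. q \<noteq> 0 \<and> fps_degree_less q n \<and> (\<forall>i<n. fps_nth (q * f) (n - 1 + i) = 0))"
    by (intro ex_cong1 conj_cong refl) (auto simp: vec_eq_iff hankel_mult_vec_nth simp del: index_mult_mat_vec)
  also have "\<dots> \<longleftrightarrow> ?R"
  proof safe
    fix q assume q: "q \<noteq> 0" "fps_degree_less q n" "\<forall>i<n. fps_nth (q * f) (n - 1 + i) = 0"
    have "fps_cutoff (2 * n - 1) (q * f) = fps_cutoff (n - 1) (q * f)"
    proof (rule fps_ext)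
      fix l
      have "fps_nth (q * f) l = 0" if "\<not> l < n - 1" "l < 2 * n - 1"
        using q(3)[rule_format, of "l - (n - 1)"] that by simp
      then show "fps_nth (fps_cutoff (2 * n - 1) (q * f)) l = fps_nth (fps_cutoff (n - 1) (q * f)) l"
        by auto
    qed
    then have "q * f - fps_cutoff (n - 1) (q * f) = fps_X ^ (2 * n - 1) * fps_shift (2 * n - 1) (q * f)"
      using fps_cutoff_plus_shift[of "2 * n - 1" "q * f"] by (simp add: algebra_simps)
    then show ?R
      using q by (intro exI[of _ q] exI[of _ "fps_cutoff (n - 1) (q * f)"]) simp
  next
    fix q p assume q: "q \<noteq> 0" "fps_degree_less q n" "fps_degree_less p (n - 1)"
      and "fps_X ^ (2 * n - 1) dvd q * f - p"
    then obtain r where r: "q * f - p = fps_X ^ (2 * n - 1) * r" by (elim dvdE)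
    have "fps_nth (q * f) (n - 1 + i) = 0" if "i < n" for i
    proof -
      have "fps_nth (q * f) (n - 1 + i) = fps_nth p (n - 1 + i) + fps_nth (fps_X ^ (2 * n - 1) * r) (n - 1 + i)"
        unfolding r[symmetric] by simp
      also have "\<dots> = 0"
        using that q(3) by (simp add: fps_degree_less_def fps_X_power_mult_nth)
      finally show ?thesis .
    qed
    with q show "\<exists>q. q \<noteq> 0 \<and> fps_degree_less q n \<and> (\<forall>i<n. fps_nth (q * f) (n - 1 + i) = 0)"
      by blast
  qed
  finally show ?thesis .
qed

text \<open>One step of a continued fraction. An approximant \<open>p / q\<close> of
  \<open>g\<close> gives \<open>D + fps_X ^ (k + 2) * p / q\<close> for the denominator of
  \<open>f\<close>, and inversion exchanges the roles of numerator and denominator.\<close>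

lemma hankel_det_continued_fraction_eq_0_iff:
  fixes f g D :: "'a::field fps"
  assumes f: "f * (D + fps_X ^ (k + 2) * g) = fps_X ^ k"
    and D: "fps_degree_less D (k + 2)" "fps_nth D 0 \<noteq> 0"
  shows "hankel_det f (n + k + 1) = 0 \<longleftrightarrow> hankel_det g n = 0"
proof
  define E where "E = D + fps_X ^ (k + 2) * g"
  have fE: "f * E = fps_X ^ k" using f by (simp add: E_def)
  have unit_E: "is_unit E"
    using D(2) by (simp add: E_def fps_is_unit_iff fps_X_power_mult_nth)
  assume "hankel_det f (n + k + 1) = 0"
  then obtain q p where q: "q \<noteq> 0" "fps_degree_less q (n + k + 1)" "fps_degree_less p (n + k)"
    \<comment> \<open>The exponent is \<open>2 * (n + k + 1) - 1\<close>, split so that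
      \<open>fps_X ^ k\<close> can be cancelled below.\<close>
    and "fps_X ^ (k + (2 * n + k + 1)) dvd q * f - p"
    unfolding hankel_det_eq_0_iff by (auto simp: algebra_simps mult_2)
  then obtain r where r: "q * f - p = fps_X ^ (k + (2 * n + k + 1)) * r"
    by (elim dvdE)
  have "p * E = q * (f * E) - (q * f - p) * E" by (simp add: algebra_simps)
  also have "\<dots> = fps_X ^ k * (q - fps_X ^ (2 * n + k + 1) * (r * E))"
    unfolding r fE power_add[of _ k] by (simp add: algebra_simps)
  finally have pE: "p * E = fps_X ^ k * (q - fps_X ^ (2 * n + k + 1) * (r * E))" .
  then have "fps_X ^ k dvd p" using unit_E by (metis dvd_mult_unit_iff dvd_triv_left)
  define p' where "p' = fps_shift k p"
  have p: "p = fps_X ^ k * p'"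
    using \<open>fps_X ^ k dvd p\<close> by (simp add: p'_def fps_X_power_times_shift_if_dvd)
  have p'_deg: "fps_degree_less p' n"
    using q(3) by (simp add: p'_def fps_degree_less_shift)
  have p'E: "p' * E = q - fps_X ^ (2 * n + k + 1) * (r * E)"
    using pE by (simp add: p mult.assoc)
  have "p' \<noteq> 0"
  proof
    assume "p' = 0"
    then have "fps_X ^ (2 * n + k + 1) dvd q" using p'E by simp
    then have "q = 0" by (rule fps_degree_less_eq_0_if_X_power_dvd[OF q(2)]) simp
    with q(1) show False by simp
  qed
  \<comment> \<open>Only now is \<open>2 * n - 1\<close> a genuine subtraction, so that
    \<open>fps_X ^ (k + 2)\<close> can be split off the error term.\<close>
  then have "n > 0" using p'_deg by (cases n) auto
  then have M: "2 * n + k + 1 = (k + 2) + (2 * n - 1)" by simp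
  \<comment> \<open>The old numerator, freed of \<open>fps_X ^ k\<close>, becomes the denominator
    for \<open>g\<close>; the new numerator is what remains of \<open>q\<close> after removing
    \<open>p' * D\<close>.\<close>
  define p'' where "p'' = fps_shift (k + 2) (q - p' * D)"
  have "q - p' * D = fps_X ^ (k + 2) * (p' * g + fps_X ^ (2 * n - 1) * (r * E))"
    using p'E unfolding M power_add[of _ "k + 2"] by (simp add: E_def algebra_simps)
  then have p'': "p'' = p' * g + fps_X ^ (2 * n - 1) * (r * E)"
    unfolding p''_def by (simp only: mult.commute[of "fps_X ^ (k + 2)"] fps_shift_times_fps_X_power')
  have "fps_degree_less (q - p' * D) (n + k + 1)"
    by (intro fps_degree_less_diff q fps_degree_less_mult[OF p'_deg D(1)]) simp
  then have "fps_degree_less p'' (n - 1)"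
    unfolding p''_def using \<open>n > 0\<close> by (intro fps_degree_less_shift) simp
  moreover have "fps_X ^ (2 * n - 1) dvd p' * g - p''" by (simp add: p'')
  ultimately show "hankel_det g n = 0"
    unfolding hankel_det_eq_0_iff using \<open>p' \<noteq> 0\<close> p'_deg by blast
next
  assume "hankel_det g n = 0"
  then obtain q p where q: "q \<noteq> 0" "fps_degree_less q n" "fps_degree_less p (n - 1)"
    and "fps_X ^ (2 * n - 1) dvd q * g - p"
    unfolding hankel_det_eq_0_iff by auto
  then obtain r where r: "q * g - p = fps_X ^ (2 * n - 1) * r"
    by (elim dvdE)
  have "n > 0" using q by (cases n) auto
  then have M: "2 * (n + k + 1) - 1 = k + ((k + 2) + (2 * n - 1))" by simp
  define E where "E = D + fps_X ^ (k + 2) * g"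
  have fE: "f * E = fps_X ^ k" using f by (simp add: E_def)
  have "is_unit E"
    using D(2) by (simp add: E_def fps_is_unit_iff fps_X_power_mult_nth)
  \<comment> \<open>This factor of \<open>f\<close> supplies the \<open>k\<close> additional orders
    of vanishing needed in the error term of \<open>q' * f\<close>.\<close>
  then have "fps_X ^ k dvd f" using fE by (metis dvd_mult_unit_iff dvd_refl)
  then obtain u where u: "f = fps_X ^ k * u" by (elim dvdE)
  define q' where "q' = q * D + fps_X ^ (k + 2) * p"
  have q': "q' = q * E - fps_X ^ ((k + 2) + (2 * n - 1)) * r"
    unfolding power_add[of _ "k + 2"] mult.assoc r[symmetric] by (simp add: q'_def E_def algebra_simps)
  have "q' * f - fps_X ^ k * q = q * (f * E) - fps_X ^ k * q - fps_X ^ ((k + 2) + (2 * n - 1)) * r * f"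
    unfolding q' by (simp add: algebra_simps)
  also have "\<dots> = fps_X ^ (k + ((k + 2) + (2 * n - 1))) * (- r * u)"
    unfolding fE power_add[of _ k "(k + 2) + (2 * n - 1)"] unfolding u by (simp add: algebra_simps)
  finally have dvd: "fps_X ^ (2 * (n + k + 1) - 1) dvd q' * f - fps_X ^ k * q"
    unfolding M by simp
  have deg_Xq: "fps_degree_less (fps_X ^ k * q) (n + k + 1 - 1)"
    by (rule fps_degree_less_mult[OF fps_degree_less_X_power q(2)]) auto
  \<comment> \<open>Otherwise a high power of \<open>fps_X\<close> would divide the numerator
    \<open>fps_X ^ k * q\<close>, a nonzero polynomial of smaller degree.\<close>
  have "q' \<noteq> 0"
  proof
    assume "q' = 0"
    with dvd have "fps_X ^ (2 * (n + k + 1) - 1) dvd fps_X ^ k * q" by simp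
    then have "fps_X ^ k * q = 0"
      by (rule fps_degree_less_eq_0_if_X_power_dvd[OF deg_Xq]) simp
    with q(1) show False by simp
  qed
  moreover have "fps_degree_less q' (n + k + 1)"
    unfolding q'_def
    by (intro fps_degree_less_add fps_degree_less_mult[OF q(2) D(1)]
          fps_degree_less_mult[OF fps_degree_less_X_power[of "k + 2" "k + 3"] q(3)])
      (use \<open>n > 0\<close> in auto)
  ultimately show "hankel_det f (n + k + 1) = 0"
    unfolding hankel_det_eq_0_iff using deg_Xq dvd by blast
qed

lemma hankel_det_zero: "n > 0 \<Longrightarrow> hankel_det (0 :: 'a::field fps) n = 0"
  unfolding hankel_det_eq_0_iff
  by (intro exI[of _ 1] exI[of _ 0]) (auto simp: fps_degree_less_def)

section \<open>Periodicity from finitely many shifts\<close>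

lemma ultimately_periodic_shiftD:
  assumes "ultimately_periodic (\<lambda>n. s (n + m))"
  shows "ultimately_periodic s"
proof -
  from assms obtain N p where p: "p > 0" "\<And>n. n \<ge> N \<Longrightarrow> s (n + p + m) = s (n + m)"
    unfolding ultimately_periodic_def by auto
  have "s (n + p) = s n" if "n \<ge> N + m" for n
    using p(2)[of "n - m"] that by (simp add: algebra_simps)
  with p(1) show ?thesis unfolding ultimately_periodic_def by blast
qed

text \<open>Pigeonhole: if no shift of \<open>s\<close> is ultimately periodic, infinitely many
  offsets keep the shift inside the finite set \<open>S\<close>, so two of these shifts
  coincide.\<close>

lemma ultimately_periodic_if_finite_shift_closed:
  assumes "finite S" "s \<in> S"
    and step: "\<And>t. t \<in> S \<Longrightarrow> ultimately_periodic t \<or> (\<exists>m>0. (\<lambda>n. t (n + m)) \<in> S)"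
  shows "ultimately_periodic s"
proof (rule ccontr)
  assume not_periodic: "\<not> ultimately_periodic s"
  define shift where "shift = (\<lambda>m n. s (n + m))"
  define M where "M = {m. shift m \<in> S}"
  have next_M: "\<exists>m'>m. m' \<in> M" if "m \<in> M" for m
  proof -
    have "\<not> ultimately_periodic (shift m)"
      using not_periodic ultimately_periodic_shiftD unfolding shift_def by blast
    with step[of "shift m"] that obtain k where "k > 0" "(\<lambda>n. shift m (n + k)) \<in> S"
      by (auto simp: M_def)
    then show ?thesis
      by (intro exI[of _ "m + k"]) (auto simp: M_def shift_def algebra_simps)
  qed
  have "0 \<in> M" using assms(2) by (simp add: M_def shift_def)
  have "infinite M"
  proof
    assume "finite M"
    with \<open>0 \<in> M\<close> have "Max M \<in> M" by (intro Max_in) auto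
    with next_M obtain m where "m > Max M" "m \<in> M" by blast
    with \<open>finite M\<close> show False by (simp add: Max.coboundedI leD)
  qed
  moreover have "finite (shift ` M)"
    using assms(1) by (rule finite_subset[rotated]) (auto simp: M_def)
  ultimately have "\<not> inj_on shift M" using finite_imageD by blast
  then obtain i j where ij: "i < j" "shift i = shift j"
    unfolding inj_on_def by (metis linorder_neqE_nat)
  have "s (n + (j - i)) = s n" if "n \<ge> i" for n
    using fun_cong[OF ij(2), of "n - i"] that ij(1) by (simp add: shift_def)
  then have "ultimately_periodic s"
    unfolding ultimately_periodic_def using ij(1) by (intro exI[of _ i] exI[of _ "j - i"]) auto
  with not_periodic show False ..
qed

section \<open>Quadratic equations in characteristic 2\<close>

lemma bit_fps_2_eq_0 [simp]: "(2 :: bit fps) = 0"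
  by (simp add: numeral_fps_const)

lemma bit_fps_add_self [simp]: "f + f = (0 :: bit fps)"
  unfolding mult_2[symmetric] by simp

instance bit :: finite
proof
  have "(UNIV :: bit set) = {0, 1}" by (auto intro: bit.exhaust)
  then show "finite (UNIV :: bit set)" by (metis finite.emptyI finite.insertI)
qed

text \<open>Only the outer coefficients vary, because a continued fraction step leaves
  \<open>V\<close> unchanged.\<close>

definition quadratic_roots :: "bit fps \<Rightarrow> nat \<Rightarrow> bit fps set" where
  "quadratic_roots V d = {f. \<exists>U W. fps_degree_less U d \<and> fps_degree_less W (d + 2) \<and>
     U + V * f + W * f\<^sup>2 = 0}"

text \<open>Over a finite field there are finitely many choices of \<open>U\<close> and
  \<open>W\<close>, and \<open>V\<close> keeps each quadratic from being the zero
  polynomial.\<close>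

lemma finite_quadratic_roots:
  assumes "V \<noteq> 0"
  shows "finite (quadratic_roots V d)"
proof (rule finite_subset)
  let ?P = "{U. fps_degree_less U d} \<times> {W. fps_degree_less W (d + 2)}"
  show "quadratic_roots V d \<subseteq> (\<Union>(U, W)\<in>?P. {f. poly [:U, V, W:] f = 0})"
    unfolding quadratic_roots_def
    by (auto simp: algebra_simps power2_eq_square)
  show "finite (\<Union>(U, W)\<in>?P. {f. poly [:U, V, W:] f = 0})"
  proof (intro finite_UN_I finite_cartesian_product finite_fps_degree_less)
    fix UW :: "bit fps \<times> bit fps"
    obtain U W where "UW = (U, W)" by (cases UW)
    with assms show "finite (case UW of (U, W) \<Rightarrow> {f. poly [:U, V, W:] f = 0})"
      using poly_roots_finite[of "[:U, V, W:]"] by simp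
  qed
qed

lemma quadratic_roots_step:
  assumes f: "f \<in> quadratic_roots V d" "f \<noteq> 0" and V: "fps_degree_less V (d + 1)"
  shows "\<exists>m>0. \<exists>g\<in>quadratic_roots V d. \<forall>n. hankel_det f (n + m) = hankel_det g n"
proof -
  from f(1) obtain U W where UW: "fps_degree_less U d" "fps_degree_less W (d + 2)"
    and eq: "U + V * f + W * f\<^sup>2 = 0"
    unfolding quadratic_roots_def by blast
  define k where "k = subdegree f"
  define u where "u = fps_shift k f"
  have f_eq: "f = u * fps_X ^ k" unfolding u_def k_def by (rule subdegree_decompose)
  have u0: "fps_nth u 0 \<noteq> 0" unfolding u_def k_def using f(2) by simp
  define E where "E = inverse u"
  have "u * E = 1" unfolding E_def using u0 by (rule inverse_mult_eq_1')
  then have fE: "f * E = fps_X ^ k" by (simp add: f_eq algebra_simps)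
  define D where "D = fps_cutoff (k + 2) E"
  define g where "g = fps_shift (k + 2) E"
  have E: "D + fps_X ^ (k + 2) * g = E" unfolding D_def g_def by (rule fps_cutoff_plus_shift)
  have D: "fps_degree_less D (k + 2)" "fps_nth D 0 \<noteq> 0"
    using u0 by (simp_all add: D_def E_def)
  have "hankel_det f (n + (k + 1)) = hankel_det g n" for n
    using hankel_det_continued_fraction_eq_0_iff[of f D k g n] fE D
    unfolding E by (cases "hankel_det g n") (simp_all add: add.assoc)
  moreover have "g \<in> quadratic_roots V d"
  proof -
    \<comment> \<open>Substituting \<open>f = fps_X ^ k / E\<close> and clearing denominators,
      \<open>N\<close> collects the terms free of \<open>g\<close>; all others carry the factor
      \<open>fps_X ^ (2 * k + 2)\<close>.\<close>
    define N where "N = U * (D * D) + V * (fps_X ^ k * D) + W * fps_X ^ (2 * k)"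
    have "0 = (U + V * f + W * f\<^sup>2) * E\<^sup>2" using eq by simp
    also have "\<dots> = U * E\<^sup>2 + V * (f * E) * E + W * (f * E)\<^sup>2"
      by (simp add: algebra_simps power2_eq_square)
    also have "\<dots> = U * E\<^sup>2 + V * fps_X ^ k * E + W * fps_X ^ (2 * k)"
      unfolding fE by (simp add: power_mult[symmetric] mult.commute)
    \<comment> \<open>The cross term vanishes in characteristic 2; otherwise it would contribute to
      the coefficient of \<open>g\<close>.\<close>
    also have "E\<^sup>2 = D * D + (fps_X ^ (k + 2) * g)\<^sup>2"
      unfolding E[symmetric] power2_sum by (simp add: power2_eq_square)
    also have "U * (D * D + (fps_X ^ (k + 2) * g)\<^sup>2) + V * fps_X ^ k * E + W * fps_X ^ (2 * k)
      = N + fps_X ^ (2 * k + 2) * (V * g + fps_X\<^sup>2 * U * g\<^sup>2)"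
      unfolding E[symmetric] N_def power_add power_mult power_mult_distrib
      by (simp only: power2_eq_square power_mult_distrib algebra_simps)
    finally have N: "N + fps_X ^ (2 * k + 2) * (V * g + fps_X\<^sup>2 * U * g\<^sup>2) = 0" ..
    then have "N = - (V * g + fps_X\<^sup>2 * U * g\<^sup>2) * fps_X ^ (2 * k + 2)"
      by (simp only: eq_neg_iff_add_eq_0 mult.commute mult_minus_right)
    then have "fps_shift (2 * k + 2) N = - (V * g + fps_X\<^sup>2 * U * g\<^sup>2)"
      by (simp only: fps_shift_times_fps_X_power')
    then have "fps_shift (2 * k + 2) N + V * g + fps_X\<^sup>2 * U * g\<^sup>2 = 0"
      by simp
    \<comment> \<open>The staggered bounds \<open>d\<close>, \<open>d + 1\<close>,
      \<open>d + 2\<close> give all three summands degree at most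
      \<open>d + 2 * k + 1\<close>.\<close>
    moreover have "fps_degree_less N (d + (2 * k + 2))"
      unfolding N_def
      by (intro fps_degree_less_add
            fps_degree_less_mult[OF UW(1) fps_degree_less_mult[OF D(1) D(1), of "2 * k + 3"]]
            fps_degree_less_mult[OF V fps_degree_less_mult[OF fps_degree_less_X_power[of k "k + 1"] D(1), of "2 * k + 2"]]
            fps_degree_less_mult[OF UW(2) fps_degree_less_X_power[of "2 * k" "2 * k + 1"]]) auto
    then have "fps_degree_less (fps_shift (2 * k + 2) N) d"
      by (rule fps_degree_less_shift)
    moreover have "fps_degree_less (fps_X\<^sup>2 * U) (d + 2)"
      by (rule fps_degree_less_mult[OF fps_degree_less_X_power[of 2 3] UW(1)]) auto
    ultimately show ?thesis unfolding quadratic_roots_def by blast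
  qed
  ultimately show ?thesis by (intro exI[of _ "k + 1"] conjI bexI[of _ g]) auto
qed

text \<open>The finite set consists of determinant sequences rather than series: on these a
  continued fraction step acts as a shift. The zero series, which has no next step, has vanishing
  determinants from index 1 on.\<close>

theorem ultimately_periodic_hankel_det_quadratic:
  assumes "f \<in> quadratic_roots V d" "V \<noteq> 0" "fps_degree_less V (d + 1)"
  shows "ultimately_periodic (hankel_det f)"
proof (rule ultimately_periodic_if_finite_shift_closed)
  show "finite (hankel_det ` quadratic_roots V d)"
    using assms(2) by (intro finite_imageI finite_quadratic_roots)
  show "hankel_det f \<in> hankel_det ` quadratic_roots V d" using assms(1) by simp
  fix t assume "t \<in> hankel_det ` quadratic_roots V d"
  then obtain h where h: "h \<in> quadratic_roots V d" "t = hankel_det h" by blast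
  show "ultimately_periodic t \<or> (\<exists>m>0. (\<lambda>n. t (n + m)) \<in> hankel_det ` quadratic_roots V d)"
  proof (cases "h = 0")
    case True
    then have "ultimately_periodic t"
      unfolding ultimately_periodic_def h(2) by (intro exI[of _ 1]) (simp add: hankel_det_zero)
    then show ?thesis ..
  next
    case False
    from quadratic_roots_step[OF h(1) False assms(3)] obtain m g
      where "m > 0" "g \<in> quadratic_roots V d" "\<And>n. t (n + m) = hankel_det g n"
      unfolding h(2) by blast
    then show ?thesis by (auto simp: fun_eq_iff intro!: exI[of _ m])
  qed
qed

section \<open>The quadratic equation for \<open>G\<close>\<close>

text \<open>A coefficient of the square depends on finitely many coefficients of \<open>s n\<close>,
  all of which are eventually constant.\<close>

lemma tendsto_power2_fps:
  fixes s :: "nat \<Rightarrow> 'a::comm_ring_1 fps"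
  assumes "s \<longlonglongrightarrow> l"
  shows "(\<lambda>n. (s n)\<^sup>2) \<longlonglongrightarrow> l\<^sup>2"
proof (rule tendsto_fpsI)
  fix k
  have "\<forall>\<^sub>F n in sequentially. \<forall>i\<in>{..k}. fps_nth (s n) i = fps_nth l i"
    using assms by (intro eventually_ball_finite) (auto simp: tendsto_fps_iff)
  then show "\<forall>\<^sub>F n in sequentially. fps_nth ((s n)\<^sup>2) k = fps_nth (l\<^sup>2) k"
    by eventually_elim (auto simp: power2_eq_square fps_mult_nth intro!: sum.cong)
qed

lemma one_plus_fps_X_power_neq_0:
  assumes "n > 0"
  shows "1 + fps_X ^ n \<noteq> (0 :: 'a::comm_semiring_1 fps)"
proof
  assume "1 + fps_X ^ n = (0 :: 'a fps)"
  from arg_cong[OF this, of "\<lambda>f. fps_nth f 0"] assms show False by simp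
qed

lemma G_quadratic:
  "1 + (1 + fps_X ^ 2 ^ b) * G a b + fps_X ^ 2 ^ a * (1 + fps_X ^ 2 ^ b) * (G a b)\<^sup>2 = 0"
proof -
  define t where "t = (\<lambda>n. fps_X ^ (2 ^ (n + a)) / (1 - fps_X ^ (2 ^ (n + b))) :: bit fps)"
  define S where "S = suminf t"
  have add_sq: "(x + y)\<^sup>2 = x\<^sup>2 + y\<^sup>2" for x y :: "bit fps"
    unfolding power2_sum by simp
  have minus_eq: "x - y = x + y" for x y :: "bit fps"
    by (simp add: fps_eq_iff)
  have t_mult: "t n * (1 + fps_X ^ 2 ^ (n + b)) = fps_X ^ 2 ^ (n + a)" for n
  proof -
    have "inverse (1 - fps_X ^ 2 ^ (n + b)) * (1 - fps_X ^ 2 ^ (n + b)) = (1 :: bit fps)"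
      by (rule inverse_mult_eq_1) simp
    then show ?thesis
      unfolding t_def G_term_eq by (simp add: mult.assoc minus_eq)
  qed
  \<comment> \<open>In characteristic 2, squaring doubles the exponents in both numerator and
    denominator.\<close>
  have t_sq: "(t n)\<^sup>2 = t (Suc n)" for n
  proof -
    have "(t n)\<^sup>2 * (1 + fps_X ^ 2 ^ (n + b))\<^sup>2 = (fps_X ^ 2 ^ (n + a))\<^sup>2"
      unfolding power_mult_distrib[symmetric] t_mult ..
    then have "(t n)\<^sup>2 * (1 + fps_X ^ 2 ^ (Suc n + b)) = t (Suc n) * (1 + fps_X ^ 2 ^ (Suc n + b))"
      unfolding t_mult add_sq by (simp add: power_mult[symmetric] mult.commute)
    moreover have "1 + fps_X ^ 2 ^ (Suc n + b) \<noteq> (0 :: bit fps)"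
      by (rule one_plus_fps_X_power_neq_0) simp
    ultimately show ?thesis by simp
  qed
  \<comment> \<open>Squaring shifts the partial sum by one index, so the sum telescopes; the
    boundary term \<open>t n\<close> tends to 0.\<close>
  have partial: "(\<Sum>i<n. t i)\<^sup>2 + (\<Sum>i<n. t i) = t 0 + t n" for n
  proof (induction n)
    case (Suc n)
    have "(\<Sum>i<Suc n. t i)\<^sup>2 + (\<Sum>i<Suc n. t i) = ((\<Sum>i<n. t i)\<^sup>2 + (\<Sum>i<n. t i)) + (t (Suc n) + t n)"
      by (simp add: add_sq t_sq algebra_simps)
    also have "\<dots> = t 0 + t (Suc n) + (t n + t n)"
      unfolding Suc.IH by (simp only: ac_simps)
    finally show ?case by simp
  qed simp
  have lim: "(\<lambda>n. \<Sum>i<n. t i) \<longlonglongrightarrow> S"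
    unfolding S_def t_def by (rule summable_LIMSEQ[OF G_summable])
  have S: "S\<^sup>2 + S = t 0"
  proof (rule fps_ext)
    fix k
    have "\<forall>\<^sub>F n in sequentially. fps_nth ((\<Sum>i<n. t i)\<^sup>2) k = fps_nth (S\<^sup>2) k"
      using tendsto_power2_fps[OF lim] by (simp add: tendsto_fps_iff)
    moreover have "\<forall>\<^sub>F n in sequentially. fps_nth (\<Sum>i<n. t i) k = fps_nth S k"
      using lim by (simp add: tendsto_fps_iff)
    moreover have "\<forall>\<^sub>F n in sequentially. fps_nth (t n) k = 0"
      using eventually_ge_at_top[of k]
    proof eventually_elim
      case (elim n)
      then have "k \<le> n + a" by simp
      also have "n + a < 2 ^ (n + a)" by (rule less_exp)
      finally show ?case unfolding t_def by (rule G_term_nth_eq_0)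
    qed
    ultimately have "\<forall>\<^sub>F n in sequentially. fps_nth (S\<^sup>2 + S) k = fps_nth (t 0) k"
    proof eventually_elim
      case (elim n)
      then show ?case using arg_cong[OF partial[of n], of "\<lambda>f. fps_nth f k"] by simp
    qed
    then show "fps_nth (S\<^sup>2 + S) k = fps_nth (t 0) k" by simp
  qed
  let ?A = "2 ^ a :: nat" and ?V = "1 + fps_X ^ 2 ^ b :: bit fps"
  have GS: "S = G a b * fps_X ^ ?A"
    unfolding S_def t_def by (rule G_mult_X_power[symmetric])
  \<comment> \<open>The additional factor \<open>fps_X ^ ?A\<close> turns \<open>G a b\<close> into
    \<open>S\<close>; it is cancelled at the end.\<close>
  have "fps_X ^ ?A * (1 + ?V * G a b + fps_X ^ ?A * ?V * (G a b)\<^sup>2) = fps_X ^ ?A + (S\<^sup>2 + S) * ?V"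
    unfolding GS by (simp add: algebra_simps power2_eq_square)
  also have "\<dots> = 0" unfolding S using t_mult[of 0] by simp
  finally show ?thesis by simp
qed

theorem theorem1p2:
  fixes a b :: nat
  shows "ultimately_periodic (hankel_det (G a b))"
proof (rule ultimately_periodic_hankel_det_quadratic)
  let ?A = "2 ^ a :: nat" and ?B = "2 ^ b :: nat"
  let ?V = "1 + fps_X ^ ?B :: bit fps"
  have X: "fps_degree_less (1 + fps_X ^ ?B :: bit fps) (?B + 1)"
    by (simp add: fps_degree_less_def)
  \<comment> \<open>The choice \<open>d = ?A + ?B\<close> leaves room for all three coefficients, of
    degrees \<open>0\<close>, \<open>?B\<close> and \<open>?A + ?B\<close>.\<close>
  have "fps_degree_less (fps_X ^ ?A * ?V) (?A + ?B + 2)"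
    by (rule fps_degree_less_mult[OF fps_degree_less_X_power[of ?A "?A + 1"] X]) auto
  moreover have "fps_degree_less (1 :: bit fps) (?A + ?B)"
    by (simp add: fps_degree_less_def)
  ultimately show "G a b \<in> quadratic_roots ?V (?A + ?B)"
    unfolding quadratic_roots_def using G_quadratic by blast
  show "?V \<noteq> 0" by (rule one_plus_fps_X_power_neq_0) simp
  show "fps_degree_less ?V (?A + ?B + 1)" using X by (rule fps_degree_less_mono) simp
qed

end
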